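(* There is an absolute constant $C>0$ such that the following holds. Let $n>2$, $\sigma>0$, and let $\bar a_1,\dots,\bar a_n\in\mathbb R^2$ have Euclidean norm at most $1$. For each $i\in[n]$ let $a_i\sim\mathcal N_2(\bar a_i,\sigma^2 I)$, independently. Then \[ \mathbb E\big[\operatorname{edges}(\operatorname{conv}(a_1,\dots,a_n))\big]\leq C\Big(\frac{\sqrt[4]{\log n}}{\sqrt\sigma}+\sqrt{\log n}\Big). \]
   Context: $\mathcal N_2(\bar a,\sigma^2 I)$ is the two-dimensional Gaussian with mean $\bar a$ and covariance $\sigma^2 I$. $\operatorname{edges}(T)$ is the number of edges of the polygon $T$. The $O(\cdot)$ is interpreted as an absolute constant $C$. *)

theory Defs
  imports "HOL-Probability.Probability"
begin

definition gauss2 :: "real ^ 2 \<Rightarrow> real \<Rightarrow> (real ^ 2) measure" where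
  "gauss2 \<mu> \<sigma> = density lborel
     (\<lambda>x. ennreal (exp (- (norm (x - \<mu>))\<^sup>2 / (2 * \<sigma>\<^sup>2)) / (2 * pi * \<sigma>\<^sup>2)))"

text \<open>
  If \<open>T\<close> is contained in a line, then \<open>T\<close> itself may count as an edge.  For three or more
  independent points with law \<^const>\<open>gauss2\<close> this happens with probability 0.
\<close>

definition num_edges :: "(real ^ 2) set \<Rightarrow> nat" where
  "num_edges T = card {e. e edge_of T}"

lemma gauss2_density_eq_prod:
  assumes "\<sigma> > 0"
  shows "exp (- (norm (x - \<mu>))\<^sup>2 / (2 * \<sigma>\<^sup>2)) / (2 * pi * \<sigma>\<^sup>2) =
    (\<Prod>b\<in>Basis. normal_density (\<mu> \<bullet> b) \<sigma> ((x :: real ^ 2) \<bullet> b))"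
proof -
  have "(\<Prod>b\<in>Basis. normal_density (\<mu> \<bullet> b) \<sigma> (x \<bullet> b)) =
      (1 / sqrt (2 * pi * \<sigma>\<^sup>2)) ^ 2 * exp (\<Sum>b\<in>Basis. - (x \<bullet> b - \<mu> \<bullet> b)\<^sup>2 / (2 * \<sigma>\<^sup>2))"
    by (simp add: normal_density_def prod.distrib exp_sum prod_dividef power_divide)
  also have "(\<Sum>b\<in>Basis. - (x \<bullet> b - \<mu> \<bullet> b)\<^sup>2 / (2 * \<sigma>\<^sup>2)) = - (norm (x - \<mu>))\<^sup>2 / (2 * \<sigma>\<^sup>2)"
    unfolding power2_norm_eq_inner
    by (subst euclidean_inner)
       (simp add: sum_negf inner_diff_left power2_eq_square flip: sum_divide_distrib)
  finally show ?thesis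
    by (simp add: power_divide)
qed

lemma prob_space_gauss2:
  assumes "\<sigma> > 0"
  shows "prob_space (gauss2 \<mu> \<sigma>)"
proof
  have one: "(\<integral>\<^sup>+x. ennreal (normal_density m \<sigma> x) \<partial>lborel) = 1" for m
    using integral_normal_density[OF assms, of m] integrable_normal_density[OF assms, of m]
    by (subst nn_integral_eq_integral) auto
  show "emeasure (gauss2 \<mu> \<sigma>) (space (gauss2 \<mu> \<sigma>)) = 1"
    unfolding gauss2_def gauss2_density_eq_prod[OF assms]
    using nn_integral_lborel_prod[of "\<lambda>b x. ennreal (normal_density (\<mu> \<bullet> b) \<sigma> x)"]
    by (simp add: emeasure_density prod_ennreal[symmetric] one)
qed

text \<open>
  Independent Gaussian random vectors on an arbitrary probability space have the product of
  the measures \<^const>\<open>gauss2\<close> as their joint law.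
\<close>

lemma (in prob_space) joint_law_gauss2:
  fixes a :: "nat \<Rightarrow> 'a \<Rightarrow> real ^ 2"
  assumes "n \<ge> 1" "indep_vars (\<lambda>_. borel) a {1..n}"
    and "\<And>i. i \<in> {1..n} \<Longrightarrow> distr M borel (a i) = gauss2 (abar i) \<sigma>"
  shows "distr M (\<Pi>\<^sub>M i\<in>{1..n}. borel) (\<lambda>\<omega>. \<lambda>i\<in>{1..n}. a i \<omega>) =
    (\<Pi>\<^sub>M i\<in>{1..n}. gauss2 (abar i) \<sigma>)"
proof -
  have "distr M (\<Pi>\<^sub>M i\<in>{1..n}. borel) (\<lambda>\<omega>. \<lambda>i\<in>{1..n}. a i \<omega>) =
      (\<Pi>\<^sub>M i\<in>{1..n}. distr M borel (a i))"
    using assms(1,2) by (subst indep_vars_iff_distr_eq_PiM'[symmetric]) (auto simp: indep_vars_def)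
  also have "\<dots> = (\<Pi>\<^sub>M i\<in>{1..n}. gauss2 (abar i) \<sigma>)"
    by (intro PiM_cong assms(3)) auto
  finally show ?thesis .
qed

end

theory Submission
  imports Defs
begin

text \<open>
  Let \<open>R = sqrt (12 ln n)\<close> and \<open>\<tau> = \<sigma> / R\<close>, and call an edge of the hull gapped if all remaining
  points have distance at least \<open>\<tau>\<close> from its line.

  Given two points \<open>x, y\<close> with unit normal \<open>w\<close>, the map \<open>(x, y) \<mapsto> (x + \<tau> w, y + \<tau> w)\<close> is a shear in
  the coordinates \<open>(x, y - x)\<close>, hence preserves Lebesgue measure. It turns edges into gapped edges,
  and it changes the Gaussian densities by at most a constant factor as long as \<open>x\<close> and \<open>y\<close> are
  within \<open>R \<sigma>\<close> of their means. Up to negligible tails, the expected number of edges is therefore at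
  most a constant times the expected number of gapped edges.

  The number of gapped edges is bounded deterministically. For two of them, with unit normals
  \<open>w, w'\<close> and starting points \<open>p, p'\<close>, one has \<open>(w - w') \<bullet> (p - p') \<ge> \<tau>\<close>. Hence, if all points have
  norm at most \<open>D\<close>, the points \<open>p + D w\<close> have mutual distance at least \<open>2 sqrt (D \<tau>)\<close>. They lie on
  the boundary of a convex set of diameter \<open>O(D)\<close>, so there are only \<open>O(1 + sqrt (D / \<tau>))\<close> of them,
  and \<open>D = 1 + R \<sigma>\<close> gives the claim.
\<close>

section \<open>Edges of planar convex hulls\<close>

lemma convex_hull_Int_supporting_hyperplane:
  fixes S :: "'a::euclidean_space set"
  assumes "compact S" "\<And>x. x \<in> S \<Longrightarrow> w \<bullet> x \<le> b"
  shows "convex hull S \<inter> {x. w \<bullet> x = b} face_of convex hull S"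
    and "convex hull S \<inter> {x. w \<bullet> x = b} = convex hull (S \<inter> {x. w \<bullet> x = b})"
proof -
  let ?F = "convex hull S \<inter> {x. w \<bullet> x = b}"
  have "convex hull S \<subseteq> {x. w \<bullet> x \<le> b}"
    by (rule hull_minimal) (use assms(2) in \<open>auto simp: convex_halfspace_le\<close>)
  then show face: "?F face_of convex hull S"
    by (intro face_of_Int_supporting_hyperplane_le) auto
  obtain S' where S': "S' \<subseteq> S" "?F = convex hull S'"
    using face_of_convex_hull_subset[OF assms(1) face] .
  have "S' \<subseteq> S \<inter> {x. w \<bullet> x = b}"
    using S' hull_subset[of S' convex] by blast
  then have "?F \<subseteq> convex hull (S \<inter> {x. w \<bullet> x = b})"
    unfolding S'(2) by (rule hull_mono)
  moreover have "convex hull (S \<inter> {x. w \<bullet> x = b}) \<subseteq> ?F"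
    using face_of_imp_convex[OF face] by (intro hull_minimal) (auto simp: hull_inc)
  ultimately show "?F = convex hull (S \<inter> {x. w \<bullet> x = b})" ..
qed

lemma edge_of_convex_hull_imp_segment:
  fixes S :: "'a::euclidean_space set"
  assumes "compact S" "e edge_of convex hull S"
  obtains u v where "u \<in> S" "v \<in> S" "u \<noteq> v" "e = closed_segment u v"
proof -
  have face: "e face_of convex hull S" and dim: "aff_dim e = 1"
    using assms(2) by (auto simp: edge_of_def)
  have "compact e"
    using face_of_imp_compact[OF convex_convex_hull _ face] assms(1)
    by (simp add: compact_convex_hull)
  moreover have "e \<noteq> {}" "convex e" "collinear e"
    using dim face face_of_imp_convex by (auto simp: collinear_aff_dim)
  ultimately obtain u v where e: "e = closed_segment u v"
    using compact_convex_collinear_segment by blast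
  have "u extreme_point_of e" "v extreme_point_of e"
    unfolding e by (simp_all add: extreme_point_of_segment)
  then have "u \<in> S" "v \<in> S"
    using face by (auto simp: extreme_point_of_face extreme_point_of_convex_hull)
  moreover have "u \<noteq> v" using dim e by auto
  ultimately show ?thesis using that e by blast
qed

definition perp :: "real ^ 2 \<Rightarrow> real ^ 2" where
  "perp d = vector [- (d $ 2), d $ 1]"

lemma perp_nth [simp]: "perp d $ 1 = - (d $ 2)" "perp d $ 2 = d $ 1"
  by (simp_all add: perp_def)

lemma inner_real2: "x \<bullet> y = x $ 1 * y $ 1 + x $ 2 * y $ 2" for x y :: "real ^ 2"
  by (simp add: inner_vec_def sum_2)

lemma linear_perp: "linear perp"
  by (rule linearI) (simp_all add: vec_eq_iff forall_2)

lemma norm_perp [simp]: "norm (perp d) = norm d"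
  by (simp add: norm_eq_sqrt_inner inner_real2)

lemma perp_inner_self [simp]: "perp d \<bullet> d = 0"
  by (simp add: inner_real2)

lemma perp_inner_commute: "perp x \<bullet> y = - (perp y \<bullet> x)"
  by (simp add: inner_real2)

lemma inner_perp_basis:
  assumes "norm b = 1"
  shows "x \<bullet> y = (b \<bullet> x) * (b \<bullet> y) + (perp b \<bullet> x) * (perp b \<bullet> y)"
proof -
  have "(b $ 1)\<^sup>2 + (b $ 2)\<^sup>2 = 1"
    using assms by (simp add: norm_eq_1 inner_real2 power2_eq_square)
  then show ?thesis unfolding inner_real2 perp_nth by algebra
qed

definition unit_normal :: "real ^ 2 \<Rightarrow> real ^ 2 \<Rightarrow> real ^ 2" where
  "unit_normal u v = perp (sgn (v - u))"

lemma unit_normal_commute: "unit_normal v u = - unit_normal u v"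
  using sgn_minus[of "v - u"] by (simp add: unit_normal_def linear_neg[OF linear_perp])

lemma norm_unit_normal: "u \<noteq> v \<Longrightarrow> norm (unit_normal u v) = 1"
  by (simp add: unit_normal_def norm_sgn)

lemma norm_unit_normal_le: "norm (unit_normal u v) \<le> 1"
  by (simp add: unit_normal_def norm_sgn)

lemma unit_normal_inner_eq: "unit_normal u v \<bullet> v = unit_normal u v \<bullet> u"
proof -
  have "unit_normal u v \<bullet> (v - u) = norm (v - u) * (unit_normal u v \<bullet> sgn (v - u))"
    by (cases "u = v") (simp_all add: sgn_div_norm)
  then show ?thesis by (simp add: unit_normal_def inner_diff_right)
qed

lemma unit_normal_inner_segment:
  assumes "x \<in> closed_segment u v"
  shows "unit_normal u v \<bullet> x = unit_normal u v \<bullet> u"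
proof -
  obtain t where "x = (1 - t) *\<^sub>R u + t *\<^sub>R v" using assms by (auto simp: in_segment)
  then show ?thesis by (simp add: inner_add_right unit_normal_inner_eq left_diff_distrib)
qed

lemma inner_eq_inner_unit_normal_mult:
  assumes "u \<noteq> v" "w \<bullet> u = w \<bullet> v"
  shows "w \<bullet> x = (unit_normal u v \<bullet> w) * (unit_normal u v \<bullet> x)"
proof -
  have "sgn (v - u) \<bullet> w = 0"
    using assms(2) by (simp add: sgn_div_norm inner_commute[of _ w] inner_diff_right)
  moreover have "norm (sgn (v - u)) = 1" using assms(1) by (simp add: norm_sgn)
  ultimately show ?thesis
    unfolding unit_normal_def using inner_perp_basis[of "sgn (v - u)" w x] by simp
qed

text \<open>If \<open>S\<close> lies on a line, both orientations of its only edge satisfy this predicate.\<close>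
definition oriented_edge :: "(real ^ 2) set \<Rightarrow> real ^ 2 \<Rightarrow> real ^ 2 \<Rightarrow> bool" where
  "oriented_edge S u v \<longleftrightarrow>
     u \<noteq> v \<and> (\<forall>x\<in>S. x \<in> closed_segment u v \<or> unit_normal u v \<bullet> (x - u) < 0)"

lemma oriented_edge_imp_edge_of:
  assumes "compact S" "u \<in> S" "v \<in> S" "oriented_edge S u v"
  shows "closed_segment u v edge_of convex hull S"
proof -
  let ?w = "unit_normal u v"
  let ?H = "{x. ?w \<bullet> x = ?w \<bullet> u}"
  have S: "x \<in> closed_segment u v \<or> ?w \<bullet> x < ?w \<bullet> u" if "x \<in> S" for x
    using assms(4) that by (auto simp: oriented_edge_def inner_diff_right)
  then have le: "?w \<bullet> x \<le> ?w \<bullet> u" if "x \<in> S" for x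
    using S[OF that] unit_normal_inner_segment[of x u v] by auto
  have "S \<inter> ?H \<subseteq> closed_segment u v" using S by fastforce
  then have "convex hull (S \<inter> ?H) \<subseteq> closed_segment u v"
    by (simp add: hull_minimal)
  moreover have "closed_segment u v \<subseteq> convex hull (S \<inter> ?H)"
    unfolding segment_convex_hull using assms(2,3)
    by (intro hull_mono) (simp add: unit_normal_inner_eq)
  ultimately have "closed_segment u v = convex hull S \<inter> ?H"
    using convex_hull_Int_supporting_hyperplane(2)[OF assms(1) le] by auto
  then have "closed_segment u v face_of convex hull S"
    using convex_hull_Int_supporting_hyperplane(1)[OF assms(1) le] by simp
  moreover have "aff_dim (closed_segment u v) = 1"
    using assms(4) by (simp add: oriented_edge_def segment_convex_hull aff_dim_convex_hull)
  ultimately show ?thesis by (simp add: edge_of_def)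
qed

lemma edge_of_imp_oriented_edge:
  assumes "finite S" "closed_segment u v edge_of convex hull S"
  shows "oriented_edge S u v \<or> oriented_edge S v u"
proof -
  have face: "closed_segment u v face_of convex hull S" and "u \<noteq> v"
    using assms(2) by (auto simp: edge_of_def)
  obtain w b where le: "convex hull S \<subseteq> {x. w \<bullet> x \<le> b}"
    and eq: "closed_segment u v = convex hull S \<inter> {x. w \<bullet> x = b}"
    using face exposed_face_of_polyhedron[OF polyhedron_convex_hull[OF assms(1)]]
    unfolding exposed_face_of_def by metis
  have wb: "w \<bullet> u = b" "w \<bullet> v = b" using eq by auto
  let ?n = "unit_normal u v"
  have S: "x \<in> closed_segment u v \<or> (?n \<bullet> w) * (?n \<bullet> (x - u)) < 0" if "x \<in> S" for x
  proof -
    have "x \<in> closed_segment u v \<or> w \<bullet> x < b"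
      using le eq hull_inc[OF that, of convex] by force
    then show ?thesis using inner_eq_inner_unit_normal_mult[OF \<open>u \<noteq> v\<close>, of w] wb
      by (simp add: inner_diff_right right_diff_distrib)
  qed
  show ?thesis
  proof (cases "?n \<bullet> w \<ge> 0")
    case True
    then have "oriented_edge S u v"
      using S \<open>u \<noteq> v\<close> by (auto simp: oriented_edge_def mult_less_0_iff)
    then show ?thesis ..
  next
    case False
    have "unit_normal v u \<bullet> (x - v) = - (?n \<bullet> (x - u))" for x
      by (simp add: unit_normal_commute[of v u] inner_diff_right unit_normal_inner_eq)
    then have "oriented_edge S v u"
      using S \<open>u \<noteq> v\<close> False
      by (auto simp: oriented_edge_def mult_less_0_iff closed_segment_commute)
    then show ?thesis ..
  qed
qed

lemma edges_of_convex_hull_eq: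
  assumes "finite S"
  shows "{e. e edge_of convex hull S} =
    (\<lambda>(u, v). closed_segment u v) ` {(u, v) \<in> S \<times> S. oriented_edge S u v}"
    (is "?E = ?seg ` ?O")
proof
  show "?E \<subseteq> ?seg ` ?O"
  proof clarify
    fix e assume e: "e edge_of convex hull S"
    obtain u v where uv: "u \<in> S" "v \<in> S" "e = closed_segment u v"
      using edge_of_convex_hull_imp_segment[OF finite_imp_compact[OF assms] e] .
    then have "(u, v) \<in> ?O \<or> (v, u) \<in> ?O"
      using edge_of_imp_oriented_edge[OF assms, of u v] e by auto
    then show "e \<in> ?seg ` ?O"
      unfolding uv(3) by (auto simp: closed_segment_commute intro: rev_image_eqI)
  qed
  show "?seg ` ?O \<subseteq> ?E"
    using oriented_edge_imp_edge_of[OF finite_imp_compact[OF assms]] by auto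
qed

section \<open>Counting gapped edges\<close>

definition gapped_edge :: "real \<Rightarrow> (real ^ 2) set \<Rightarrow> real ^ 2 \<Rightarrow> real ^ 2 \<Rightarrow> bool" where
  "gapped_edge \<tau> S u v \<longleftrightarrow> u \<noteq> v \<and> (\<forall>x\<in>S. unit_normal u v \<bullet> (x - u) \<le> - \<tau>)"

lemma gapped_edge_translate:
  "gapped_edge \<tau> S (u + s *\<^sub>R unit_normal u v) (v + s *\<^sub>R unit_normal u v) \<longleftrightarrow>
    gapped_edge (\<tau> - s) S u v"
proof (cases "u = v")
  case False
  have translate: "unit_normal (u + z) (v + z) = unit_normal u v" for z
    by (simp add: unit_normal_def)
  have "unit_normal u v \<bullet> unit_normal u v = 1"
    using norm_unit_normal[OF False] by (simp add: norm_eq_1)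
  then show ?thesis
    unfolding gapped_edge_def translate using False
    by (simp add: inner_diff_right inner_add_right algebra_simps)
qed (simp add: gapped_edge_def)

definition gapped_edges :: "real \<Rightarrow> 'i set \<Rightarrow> ('i \<Rightarrow> real ^ 2) \<Rightarrow> ('i \<times> 'i) set" where
  "gapped_edges \<tau> I a = {(i, j) \<in> I \<times> I. gapped_edge \<tau> (a ` (I - {i, j})) (a i) (a j)}"

lemma finite_gapped_edges [simp]: "finite I \<Longrightarrow> finite (gapped_edges \<tau> I a)"
  by (rule finite_subset[of _ "I \<times> I"]) (auto simp: gapped_edges_def)

lemma gapped_edgesD:
  assumes "(i, j) \<in> gapped_edges \<tau> I a"
  shows "i \<in> I" "j \<in> I" "a i \<noteq> a j"
    and "\<And>k. k \<in> I \<Longrightarrow> k \<noteq> i \<Longrightarrow> k \<noteq> j \<Longrightarrow> \<tau> \<le> unit_normal (a i) (a j) \<bullet> (a i - a k)"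
  using assms by (auto simp: gapped_edges_def gapped_edge_def inner_diff_right algebra_simps)

definition shear_pair :: "('a::ab_group_add \<Rightarrow> 'a) \<Rightarrow> 'i \<Rightarrow> 'i \<Rightarrow> ('i \<Rightarrow> 'a) \<Rightarrow> 'i \<Rightarrow> 'a" where
  "shear_pair g i j a = a(i := a i + g (a j - a i), j := a j + g (a j - a i))"

lemma gapped_edges_shear_pair:
  assumes "i \<noteq> j"
  shows "(i, j) \<in> gapped_edges \<tau> I (shear_pair (\<lambda>d. s *\<^sub>R unit_normal 0 d) i j a) \<longleftrightarrow>
    (i, j) \<in> gapped_edges (\<tau> - s) I a"
proof -
  define b where "b = shear_pair (\<lambda>d. s *\<^sub>R unit_normal 0 d) i j a"
  have "unit_normal 0 (v - u) = unit_normal u v" for u v by (simp add: unit_normal_def)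
  then have "b i = a i + s *\<^sub>R unit_normal (a i) (a j)" "b j = a j + s *\<^sub>R unit_normal (a i) (a j)"
    and "b ` (I - {i, j}) = a ` (I - {i, j})"
    using assms by (auto simp: b_def shear_pair_def intro!: image_cong)
  then show ?thesis by (simp add: gapped_edges_def gapped_edge_translate flip: b_def)
qed

lemma num_edges_le_card_gapped_edges:
  assumes "finite I"
  shows "num_edges (convex hull (a ` I)) \<le> card (gapped_edges 0 I a)"
  unfolding num_edges_def
proof (rule surj_card_le)
  have "(i, j) \<in> gapped_edges 0 I a" if "i \<in> I" "j \<in> I" "oriented_edge (a ` I) (a i) (a j)" for i j
  proof -
    have "unit_normal (a i) (a j) \<bullet> (a k - a i) \<le> 0" if "k \<in> I" for k
      using \<open>oriented_edge (a ` I) (a i) (a j)\<close> that unit_normal_inner_segment[of "a k" "a i" "a j"]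
      by (auto simp: oriented_edge_def inner_diff_right)
    then show ?thesis using that by (auto simp: gapped_edges_def gapped_edge_def oriented_edge_def)
  qed
  then show "{e. e edge_of convex hull (a ` I)} \<subseteq>
      (\<lambda>(i, j). closed_segment (a i) (a j)) ` gapped_edges 0 I a"
    unfolding edges_of_convex_hull_eq[OF finite_imageI[OF assms]] by force
qed (use assms in simp)

lemma gapped_edges_inner_nonneg:
  assumes "(i, j) \<in> gapped_edges \<tau> I a" "\<tau> \<ge> 0" "k \<in> I"
  shows "0 \<le> unit_normal (a i) (a j) \<bullet> (a i - a k)"
proof (cases "k = i \<or> k = j")
  case True
  then show ?thesis by (auto simp: inner_diff_right unit_normal_inner_eq)
next
  case False
  then show ?thesis using gapped_edgesD(4)[OF assms(1,3)] assms(2) by auto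
qed

lemma inj_on_fst_gapped_edges:
  assumes "\<tau> > 0"
  shows "inj_on fst (gapped_edges \<tau> I a)"
proof (rule inj_onI, rule ccontr)
  fix e f assume ef: "e \<in> gapped_edges \<tau> I a" "f \<in> gapped_edges \<tau> I a" "fst e = fst f" "e \<noteq> f"
  obtain i j l where [simp]: "e = (i, j)" "f = (i, l)" and "j \<noteq> l"
    using ef(3,4) by (cases e; cases f) auto
  have neg: "perp (a j - a i) \<bullet> (a l - a i) < 0"
    if "(i, j) \<in> gapped_edges \<tau> I a" "(i, l) \<in> gapped_edges \<tau> I a" "j \<noteq> l" for j l
  proof -
    have "unit_normal (a i) (a j) \<bullet> (a l - a i) < 0"
      using gapped_edgesD(4)[OF that(1), of l] gapped_edgesD(2,3)[OF that(2)] that(3) assms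
      by (force simp: inner_diff_right)
    then show ?thesis
      using gapped_edgesD(3)[OF that(1)]
      by (simp add: unit_normal_def sgn_div_norm linear_scale[OF linear_perp] mult_less_0_iff)
  qed
  show False
    using neg[of j l] neg[of l j] ef \<open>j \<noteq> l\<close> perp_inner_commute[of "a j - a i" "a l - a i"] by simp
qed

lemma gapped_edges_asym:
  assumes "(i, j) \<in> gapped_edges \<tau> I a" "\<tau> > 0" "3 \<le> card I"
  shows "(j, i) \<notin> gapped_edges \<tau> I a"
proof
  assume rev: "(j, i) \<in> gapped_edges \<tau> I a"
  have "\<not> I \<subseteq> {i, j}"
  proof
    assume "I \<subseteq> {i, j}"
    then have "card I \<le> card {i, j}" by (intro card_mono) auto
    then show False using assms(3) by (simp add: card_insert_if split: if_splits)
  qed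
  then obtain m where "m \<in> I" "m \<noteq> i" "m \<noteq> j" by auto
  then show False
    using gapped_edgesD(4)[OF assms(1), of m] gapped_edgesD(4)[OF rev, of m] assms(2)
    by (simp add: unit_normal_commute[of "a j" "a i"] inner_diff_right unit_normal_inner_eq)
qed

lemma gapped_edges_separated:
  assumes "\<tau> > 0" "3 \<le> card I" "(i, j) \<in> gapped_edges \<tau> I a" "(k, l) \<in> gapped_edges \<tau> I a"
    and "(i, j) \<noteq> (k, l)"
  shows "\<tau> \<le> (unit_normal (a i) (a j) - unit_normal (a k) (a l)) \<bullet> (a i - a k)"
proof -
  let ?n = "unit_normal (a i) (a j)" and ?m = "unit_normal (a k) (a l)"
  have "i \<noteq> k"
    using inj_onD[OF inj_on_fst_gapped_edges[OF assms(1)] _ assms(3,4)] assms(5) by auto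
  have ik: "i \<in> I" "k \<in> I" using assms(3,4) by (auto dest: gapped_edgesD(1))
  have "0 \<le> ?n \<bullet> (a i - a k)" "0 \<le> ?m \<bullet> (a k - a i)"
    using gapped_edges_inner_nonneg[OF assms(3)] gapped_edges_inner_nonneg[OF assms(4)] assms(1) ik
    by auto
  moreover have "k \<noteq> j \<or> i \<noteq> l" using gapped_edges_asym[OF assms(3,1,2)] assms(4) by auto
  then have "\<tau> \<le> ?n \<bullet> (a i - a k) \<or> \<tau> \<le> ?m \<bullet> (a k - a i)"
    using gapped_edgesD(4) assms(3,4) ik \<open>i \<noteq> k\<close> by metis
  ultimately show ?thesis by (auto simp: inner_diff_left inner_diff_right)
qed

lemma card_separated_reals_le:
  fixes f :: "'a \<Rightarrow> real"
  assumes "finite A" "g > 0" "B \<ge> 0" "\<And>x. x \<in> A \<Longrightarrow> \<bar>f x\<bar> \<le> B"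
    and "\<And>x y. x \<in> A \<Longrightarrow> y \<in> A \<Longrightarrow> x \<noteq> y \<Longrightarrow> g \<le> \<bar>f x - f y\<bar>"
  shows "real (card A) \<le> 1 + 2 * B / g"
proof -
  let ?h = "\<lambda>x. \<lfloor>(f x + B) / g\<rfloor>"
  have inj: "inj_on ?h A"
  proof (rule inj_onI, rule ccontr)
    fix x y assume xy: "x \<in> A" "y \<in> A" "?h x = ?h y" "x \<noteq> y"
    then have "\<bar>(f x + B) / g - (f y + B) / g\<bar> < 1" by linarith
    also have "(f x + B) / g - (f y + B) / g = (f x - f y) / g"
      by (simp add: diff_divide_distrib[symmetric])
    finally show False using assms(5)[OF xy(1,2,4)] assms(2) by (simp add: abs_divide)
  qed
  have "?h ` A \<subseteq> {0..\<lfloor>2 * B / g\<rfloor>}"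
  proof clarify
    fix x assume "x \<in> A"
    then have "\<bar>f x\<bar> \<le> B" by (rule assms(4))
    then have "0 \<le> (f x + B) / g" "(f x + B) / g \<le> 2 * B / g"
      using assms(2) by (auto intro!: divide_nonneg_pos divide_right_mono)
    then show "?h x \<in> {0..\<lfloor>2 * B / g\<rfloor>}" by (simp add: floor_mono)
  qed
  then have "card A \<le> card {0..\<lfloor>2 * B / g\<rfloor>}"
    using inj by (metis card_image card_mono finite_atLeastAtMost_int)
  then have "real (card A) \<le> real (nat (\<lfloor>2 * B / g\<rfloor> + 1))" by simp
  also have "\<dots> \<le> 1 + 2 * B / g" using assms(2,3) by simp
  finally show ?thesis .
qed

lemma norm_le_abs_inner_diff_in_quadrant:
  assumes "norm b = 1" "w \<noteq> 0" "0 \<le> b \<bullet> w" "0 \<le> perp b \<bullet> w" "w' \<noteq> 0" "0 \<le> b \<bullet> w'" "0 \<le> perp b \<bullet> w'"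
    and "0 \<le> w \<bullet> d" "w' \<bullet> d \<le> 0"
  shows "norm d \<le> \<bar>(b - perp b) \<bullet> d\<bar>"
proof -
  note basis = inner_perp_basis[OF assms(1)]
  have pos: "0 < v \<bullet> z"
    if "v \<noteq> 0" "0 \<le> b \<bullet> v" "0 \<le> perp b \<bullet> v" "0 < b \<bullet> z" "0 < perp b \<bullet> z" for v z
  proof -
    have "b \<bullet> v \<noteq> 0 \<or> perp b \<bullet> v \<noteq> 0" using basis[of v v] that(1) by auto
    then have "0 < b \<bullet> v \<or> 0 < perp b \<bullet> v" using that(2,3) by linarith
    then show ?thesis
      unfolding basis[of v z] using that by (auto intro: add_pos_nonneg add_nonneg_pos)
  qed
  have "\<not> (0 < b \<bullet> d \<and> 0 < perp b \<bullet> d)" "\<not> (b \<bullet> d < 0 \<and> perp b \<bullet> d < 0)"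
    using pos[OF assms(5-7), of d] pos[OF assms(2-4), of "- d"] assms(8,9) by auto
  then have "(b \<bullet> d) * (perp b \<bullet> d) \<le> 0"
    by (auto simp: mult_le_0_iff not_less)
  then have "(norm d)\<^sup>2 \<le> ((b - perp b) \<bullet> d)\<^sup>2"
    unfolding power2_norm_eq_inner basis[of d d] 
    by (simp add: inner_diff_left power2_diff power2_eq_square algebra_simps)
  then show ?thesis using real_le_rsqrt real_sqrt_abs by metis
qed

text \<open>
  The increments of \<open>q\<close> have coordinates of opposite sign in the basis \<open>b, perp b\<close>, so the
  difference of the coordinates separates the points.
\<close>
lemma card_separated_in_quadrant_le:
  fixes q w :: "'a \<Rightarrow> real ^ 2"
  assumes "finite A" "g > 0" "r \<ge> 0" and b: "norm b = 1"
    and bounded: "\<And>x. x \<in> A \<Longrightarrow> norm (q x) \<le> r"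
    and quadrant: "\<And>x. x \<in> A \<Longrightarrow> w x \<noteq> 0 \<and> 0 \<le> b \<bullet> w x \<and> 0 \<le> perp b \<bullet> w x"
    and supporting: "\<And>x y. x \<in> A \<Longrightarrow> y \<in> A \<Longrightarrow> 0 \<le> w x \<bullet> (q x - q y)"
    and separated: "\<And>x y. x \<in> A \<Longrightarrow> y \<in> A \<Longrightarrow> x \<noteq> y \<Longrightarrow> g \<le> dist (q x) (q y)"
  shows "real (card A) \<le> 1 + 4 * r / g"
proof -
  have "real (card A) \<le> 1 + 2 * (2 * r) / g"
  proof (rule card_separated_reals_le[where f = "\<lambda>x. (b - perp b) \<bullet> q x"])
    fix x assume "x \<in> A"
    have "norm (b - perp b) \<le> 2" using norm_triangle_ineq4[of b "perp b"] b by simp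
    then have "norm (b - perp b) * norm (q x) \<le> 2 * r"
      using \<open>r \<ge> 0\<close> bounded[OF \<open>x \<in> A\<close>] by (intro mult_mono) auto
    then show "\<bar>(b - perp b) \<bullet> q x\<bar> \<le> 2 * r"
      using Cauchy_Schwarz_ineq2[of "b - perp b" "q x"] by linarith
  next
    fix x y assume xy: "x \<in> A" "y \<in> A" "x \<noteq> y"
    have "w y \<bullet> (q x - q y) \<le> 0" using supporting[OF xy(2,1)] by (simp add: inner_diff_right)
    then have "norm (q x - q y) \<le> \<bar>(b - perp b) \<bullet> (q x - q y)\<bar>"
      using b quadrant supporting xy(1,2)
      by (intro norm_le_abs_inner_diff_in_quadrant[of b "w x" "w y"]) auto
    then show "g \<le> \<bar>(b - perp b) \<bullet> q x - (b - perp b) \<bullet> q y\<bar>"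
      using separated[OF xy] by (simp add: dist_norm inner_diff_right)
  qed (use assms(1-3) in auto)
  then show ?thesis by simp
qed

lemma card_separated_in_convex_position_le:
  fixes q w :: "'a \<Rightarrow> real ^ 2"
  assumes "finite A" "g > 0" "r \<ge> 0"
    and "\<And>x. x \<in> A \<Longrightarrow> norm (q x) \<le> r" "\<And>x. x \<in> A \<Longrightarrow> w x \<noteq> 0"
    and "\<And>x y. x \<in> A \<Longrightarrow> y \<in> A \<Longrightarrow> 0 \<le> w x \<bullet> (q x - q y)"
    and "\<And>x y. x \<in> A \<Longrightarrow> y \<in> A \<Longrightarrow> x \<noteq> y \<Longrightarrow> g \<le> dist (q x) (q y)"
  shows "real (card A) \<le> 4 * (1 + 4 * r / g)"
proof -
  define Q where "Q b = {x \<in> A. 0 \<le> b \<bullet> w x \<and> 0 \<le> perp b \<bullet> w x}" for b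
  define e :: "real ^ 2" where "e = axis 1 1"
  let ?B = "{e, perp e, - e, - perp e}"
  have "norm e = 1" by (simp add: e_def)
  have card_Q: "real (card (Q b)) \<le> 1 + 4 * r / g" if "b \<in> ?B" for b
  proof (rule card_separated_in_quadrant_le[where q = q and w = w and b = b])
    show "norm b = 1" using that \<open>norm e = 1\<close> by auto
  qed (use assms in \<open>auto simp: Q_def\<close>)
  have "A \<subseteq> (\<Union>b\<in>?B. Q b)"
    by (auto simp: Q_def e_def inner_real2 axis_def)
  then have "card A \<le> card (\<Union>b\<in>?B. Q b)"
    using assms(1) by (intro card_mono) (auto simp: Q_def)
  also have "\<dots> \<le> (\<Sum>b\<in>?B. card (Q b))" by (rule card_UN_le) simp
  finally have "real (card A) \<le> (\<Sum>b\<in>?B. real (card (Q b)))"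
    by (simp flip: of_nat_sum)
  also have "\<dots> \<le> real (card ?B) * (1 + 4 * r / g)"
    using card_Q by (rule sum_bounded_above)
  also have "\<dots> \<le> 4 * (1 + 4 * r / g)"
    using assms(2,3) by (intro mult_right_mono) (auto simp: card_insert_if)
  finally show ?thesis .
qed

lemma four_inner_le_norm_add_squared: "4 * (x \<bullet> y) \<le> (norm (x + y))\<^sup>2"
  using zero_le_power2[of "norm (x - y)"]
  unfolding power2_norm_eq_inner by (simp add: inner_simps inner_commute)

lemma card_monotone_unit_normals_le:
  fixes p w :: "'a \<Rightarrow> real ^ 2"
  assumes "finite A" "\<tau> > 0" "D > 0"
    and bounded: "\<And>x. x \<in> A \<Longrightarrow> norm (p x) \<le> D" and unit: "\<And>x. x \<in> A \<Longrightarrow> norm (w x) = 1"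
    and supporting: "\<And>x y. x \<in> A \<Longrightarrow> y \<in> A \<Longrightarrow> 0 \<le> w x \<bullet> (p x - p y)"
    and monotone: "\<And>x y. x \<in> A \<Longrightarrow> y \<in> A \<Longrightarrow> x \<noteq> y \<Longrightarrow> \<tau> \<le> (w x - w y) \<bullet> (p x - p y)"
  shows "real (card A) \<le> 4 * (1 + 4 * sqrt (D / \<tau>))"
proof -
  define q where "q x = p x + D *\<^sub>R w x" for x
  have diff: "q x - q y = (p x - p y) + D *\<^sub>R (w x - w y)" for x y
    by (simp add: q_def scaleR_diff_right)
  have "real (card A) \<le> 4 * (1 + 4 * (2 * D) / (2 * sqrt (D * \<tau>)))"
  proof (rule card_separated_in_convex_position_le[where q = q and w = w])
    fix x assume x: "x \<in> A"
    show "w x \<noteq> 0" using unit[OF x] by auto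
    show "norm (q x) \<le> 2 * D"
      using norm_triangle_ineq[of "p x" "D *\<^sub>R w x"] bounded[OF x] unit[OF x] \<open>D > 0\<close>
      by (simp add: q_def)
  next
    fix x y assume xy: "x \<in> A" "y \<in> A"
    have "w x \<bullet> w y \<le> w x \<bullet> w x"
      using norm_cauchy_schwarz[of "w x" "w y"] unit xy norm_eq_1[of "w x"] by simp
    then show "0 \<le> w x \<bullet> (q x - q y)"
      unfolding diff using supporting[OF xy] \<open>D > 0\<close>
      by (simp add: inner_add_right inner_diff_right mult_left_mono)
    assume "x \<noteq> y"
    have "4 * (D * \<tau>) \<le> 4 * ((p x - p y) \<bullet> (D *\<^sub>R (w x - w y)))"
      using monotone[OF xy \<open>x \<noteq> y\<close>] \<open>D > 0\<close> by (simp add: inner_commute)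
    also have "\<dots> \<le> (norm (q x - q y))\<^sup>2"
      unfolding diff by (rule four_inner_le_norm_add_squared)
    finally have "sqrt (4 * (D * \<tau>)) \<le> norm (q x - q y)"
      by (intro real_le_lsqrt) auto
    then show "2 * sqrt (D * \<tau>) \<le> dist (q x) (q y)" by (simp add: real_sqrt_mult dist_norm)
  qed (use assms(1-3) in auto)
  also have "4 * (2 * D) / (2 * sqrt (D * \<tau>)) = 4 * sqrt (D / \<tau>)"
    using assms(2,3) by (simp add: real_sqrt_mult real_sqrt_divide field_simps)
  finally show ?thesis .
qed

lemma card_gapped_edges_le:
  assumes "finite I" "3 \<le> card I" "\<tau> > 0" "D > 0" "\<And>k. k \<in> I \<Longrightarrow> norm (a k) \<le> D"
  shows "real (card (gapped_edges \<tau> I a)) \<le> 4 * (1 + 4 * sqrt (D / \<tau>))"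
proof -
  let ?p = "\<lambda>(i, j). a i" and ?w = "\<lambda>(i, j). unit_normal (a i) (a j)"
  note memD = gapped_edgesD[of _ _ \<tau> I a]
  show ?thesis
  proof (rule card_monotone_unit_normals_le[where p = ?p and w = ?w])
    show "norm (?p e) \<le> D" "norm (?w e) = 1" if "e \<in> gapped_edges \<tau> I a" for e
      using that assms(5) memD(1,3)[of "fst e" "snd e"] by (cases e; simp add: norm_unit_normal)+
    show "0 \<le> ?w e \<bullet> (?p e - ?p f)" if "e \<in> gapped_edges \<tau> I a" "f \<in> gapped_edges \<tau> I a" for e f
      using that assms(3) memD(1)[of "fst f" "snd f"] gapped_edges_inner_nonneg[of _ _ \<tau> I a]
      by (cases e; cases f) simp
    show "\<tau> \<le> (?w e - ?w f) \<bullet> (?p e - ?p f)"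
      if "e \<in> gapped_edges \<tau> I a" "f \<in> gapped_edges \<tau> I a" "e \<noteq> f" for e f
      using that gapped_edges_separated[OF assms(3,2)] by (cases e; cases f) simp
  qed (use assms in auto)
qed

section \<open>The shear under a pair of Gaussian measures\<close>

lemma nn_integral_lborel_plus:
  fixes c :: "'a :: euclidean_space"
  assumes [measurable]: "f \<in> borel_measurable borel"
  shows "(\<integral>\<^sup>+x. f (c + x) \<partial>lborel) = (\<integral>\<^sup>+x. f x \<partial>lborel)"
proof -
  have "(\<integral>\<^sup>+x. f x \<partial>lborel) = (\<integral>\<^sup>+x. f x \<partial>distr lborel borel ((+) c))"
    by (simp add: lborel_distr_plus)
  also have "\<dots> = (\<integral>\<^sup>+x. f (c + x) \<partial>lborel)"
    by (subst nn_integral_distr) auto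
  finally show ?thesis ..
qed

lemma nn_integral_shear:
  fixes f :: "'a :: euclidean_space \<Rightarrow> 'a \<Rightarrow> ennreal"
  assumes [measurable]: "case_prod f \<in> borel_measurable (borel \<Otimes>\<^sub>M borel)"
    and [measurable]: "g \<in> borel_measurable borel"
  shows "(\<integral>\<^sup>+x. \<integral>\<^sup>+y. f (x + g (y - x)) (y + g (y - x)) \<partial>lborel \<partial>lborel)
    = (\<integral>\<^sup>+x. \<integral>\<^sup>+y. f x y \<partial>lborel \<partial>lborel)"
proof -
  have translate_y: "(\<integral>\<^sup>+y. f (x + g (y - x)) (y + g (y - x)) \<partial>lborel)
      = (\<integral>\<^sup>+d. f (x + g d) (x + d + g d) \<partial>lborel)" for x
    using nn_integral_lborel_plus[of "\<lambda>y. f (x + g (y - x)) (y + g (y - x))" x] by simp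
  have translate_x: "(\<integral>\<^sup>+x. f (x + g d) (x + d + g d) \<partial>lborel) = (\<integral>\<^sup>+x. f x (x + d) \<partial>lborel)" for d
    using nn_integral_lborel_plus[of "\<lambda>x. f x (x + d)" "g d"] by (simp add: ac_simps)
  have "(\<integral>\<^sup>+x. \<integral>\<^sup>+y. f (x + g (y - x)) (y + g (y - x)) \<partial>lborel \<partial>lborel)
      = (\<integral>\<^sup>+x. \<integral>\<^sup>+d. f (x + g d) (x + d + g d) \<partial>lborel \<partial>lborel)"
    by (simp only: translate_y)
  also have "\<dots> = (\<integral>\<^sup>+d. \<integral>\<^sup>+x. f (x + g d) (x + d + g d) \<partial>lborel \<partial>lborel)"
    by (rule lborel_pair.Fubini') simp
  also have "\<dots> = (\<integral>\<^sup>+d. \<integral>\<^sup>+x. f x (x + d) \<partial>lborel \<partial>lborel)"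
    by (simp only: translate_x)
  also have "\<dots> = (\<integral>\<^sup>+x. \<integral>\<^sup>+d. f x (x + d) \<partial>lborel \<partial>lborel)"
    by (rule lborel_pair.Fubini') simp
  also have "\<dots> = (\<integral>\<^sup>+x. \<integral>\<^sup>+y. f x y \<partial>lborel \<partial>lborel)"
    by (subst nn_integral_lborel_plus) simp_all
  finally show ?thesis .
qed

definition gauss2_density :: "real ^ 2 \<Rightarrow> real \<Rightarrow> real ^ 2 \<Rightarrow> real" where
  "gauss2_density \<mu> \<sigma> x = exp (- (norm (x - \<mu>))\<^sup>2 / (2 * \<sigma>\<^sup>2)) / (2 * pi * \<sigma>\<^sup>2)"

lemma gauss2_eq_density: "gauss2 \<mu> \<sigma> = density lborel (\<lambda>x. ennreal (gauss2_density \<mu> \<sigma> x))"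
  by (simp add: gauss2_def gauss2_density_def)

lemma gauss2_density_nonneg [simp]: "0 \<le> gauss2_density \<mu> \<sigma> x"
  by (simp add: gauss2_density_def)

lemma borel_measurable_gauss2_density [measurable]: "gauss2_density \<mu> \<sigma> \<in> borel_measurable borel"
  unfolding gauss2_density_def by measurable

lemma sets_gauss2 [simp, measurable_cong]: "sets (gauss2 \<mu> \<sigma>) = sets borel"
  by (simp add: gauss2_def)

lemma space_gauss2 [simp]: "space (gauss2 \<mu> \<sigma>) = UNIV"
  by (simp add: gauss2_def)

lemma nn_integral_gauss2:
  assumes [measurable]: "f \<in> borel_measurable borel"
  shows "(\<integral>\<^sup>+x. f x \<partial>gauss2 \<mu> \<sigma>) = (\<integral>\<^sup>+x. ennreal (gauss2_density \<mu> \<sigma> x) * f x \<partial>lborel)"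
  unfolding gauss2_eq_density by (rule nn_integral_density) auto

lemma nn_integral_gauss2_pair:
  assumes [measurable]: "case_prod f \<in> borel_measurable (borel \<Otimes>\<^sub>M borel)"
  shows "(\<integral>\<^sup>+x. \<integral>\<^sup>+y. f x y \<partial>gauss2 \<nu> \<sigma> \<partial>gauss2 \<mu> \<sigma>) =
    (\<integral>\<^sup>+x. \<integral>\<^sup>+y. ennreal (gauss2_density \<mu> \<sigma> x * gauss2_density \<nu> \<sigma> y) * f x y \<partial>lborel \<partial>lborel)"
  by (simp add: nn_integral_gauss2 nn_integral_cmult[symmetric] ennreal_mult' mult.assoc)

lemma gauss2_density_shift_le:
  assumes "\<sigma> > 0" "R \<ge> 1" "x \<in> cball \<mu> (R * \<sigma>)" "norm z \<le> \<sigma> / R"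
  shows "gauss2_density \<mu> \<sigma> x \<le> exp (3 / 2) * gauss2_density \<mu> \<sigma> (x + z)"
proof -
  let ?r = "norm (x - \<mu>)" and ?s = "norm (x + z - \<mu>)"
  have r: "?r \<le> R * \<sigma>" using assms(3) by (simp add: dist_norm norm_minus_commute)
  have z: "norm z \<le> \<sigma>"
    using assms(1,2) by (intro order_trans[OF assms(4)]) (simp add: divide_le_eq)
  have "?s\<^sup>2 \<le> (?r + norm z)\<^sup>2"
    using norm_triangle_ineq[of "x - \<mu>" z] by (intro power_mono) (auto simp: algebra_simps)
  also have "\<dots> = ?r\<^sup>2 + 2 * (?r * norm z) + (norm z)\<^sup>2" by (simp add: power2_sum)
  also have "?r * norm z \<le> (R * \<sigma>) * (\<sigma> / R)"
    using r assms by (intro mult_mono) auto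
  also have "(R * \<sigma>) * (\<sigma> / R) = \<sigma>\<^sup>2" using assms(2) by (simp add: power2_eq_square)
  also have "(norm z)\<^sup>2 \<le> \<sigma>\<^sup>2" using z by (intro power_mono) auto
  finally have "?s\<^sup>2 \<le> ?r\<^sup>2 + 3 * \<sigma>\<^sup>2" by simp
  then have "- ?r\<^sup>2 / (2 * \<sigma>\<^sup>2) \<le> 3 / 2 + - ?s\<^sup>2 / (2 * \<sigma>\<^sup>2)"
    using assms(1) by (simp add: field_simps)
  then have "exp (- ?r\<^sup>2 / (2 * \<sigma>\<^sup>2)) \<le> exp (3 / 2) * exp (- ?s\<^sup>2 / (2 * \<sigma>\<^sup>2))"
    unfolding exp_add[symmetric] by simp
  then show ?thesis
    unfolding gauss2_density_def times_divide_eq_right by (intro divide_right_mono) auto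
qed

lemma nn_integral_gauss2_shear_le:
  assumes "\<sigma> > 0" "R \<ge> 1"
    and [measurable]: "case_prod f \<in> borel_measurable (borel \<Otimes>\<^sub>M borel)"
      "g \<in> borel_measurable borel"
    and g: "\<And>d. norm (g d) \<le> \<sigma> / R"
  shows "(\<integral>\<^sup>+x. \<integral>\<^sup>+y. (if x \<in> cball \<mu> (R * \<sigma>) \<and> y \<in> cball \<nu> (R * \<sigma>)
        then f (x + g (y - x)) (y + g (y - x)) else 0) \<partial>gauss2 \<nu> \<sigma> \<partial>gauss2 \<mu> \<sigma>)
    \<le> ennreal (exp 3) * (\<integral>\<^sup>+x. \<integral>\<^sup>+y. f x y \<partial>gauss2 \<nu> \<sigma> \<partial>gauss2 \<mu> \<sigma>)"
proof -
  let ?p = "\<lambda>x y. gauss2_density \<mu> \<sigma> x * gauss2_density \<nu> \<sigma> y"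
  let ?near = "\<lambda>x y. x \<in> cball \<mu> (R * \<sigma>) \<and> y \<in> cball \<nu> (R * \<sigma>)"
  let ?F = "\<lambda>x y. ennreal (exp 3) * (ennreal (?p x y) * f x y)"
  have density: "?p x y \<le> exp 3 * ?p (x + z) (y + z)" if "?near x y" "norm z \<le> \<sigma> / R" for x y z
  proof -
    have "?p x y \<le>
        (exp (3 / 2) * gauss2_density \<mu> \<sigma> (x + z)) * (exp (3 / 2) * gauss2_density \<nu> \<sigma> (y + z))"
      using that assms(1,2) by (intro mult_mono gauss2_density_shift_le) auto
    also have "\<dots> = (exp (3 / 2) * exp (3 / 2)) * ?p (x + z) (y + z)" by (simp add: ac_simps)
    finally show ?thesis by (simp add: exp_add[symmetric])
  qed
  have "(\<integral>\<^sup>+x. \<integral>\<^sup>+y. (if ?near x y then f (x + g (y - x)) (y + g (y - x)) else 0)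
        \<partial>gauss2 \<nu> \<sigma> \<partial>gauss2 \<mu> \<sigma>)
      = (\<integral>\<^sup>+x. \<integral>\<^sup>+y. ennreal (?p x y) *
          (if ?near x y then f (x + g (y - x)) (y + g (y - x)) else 0) \<partial>lborel \<partial>lborel)"
    by (rule nn_integral_gauss2_pair) (simp add: mem_cball)
  also have "\<dots> \<le> (\<integral>\<^sup>+x. \<integral>\<^sup>+y. ?F (x + g (y - x)) (y + g (y - x)) \<partial>lborel \<partial>lborel)"
    using ennreal_leI[OF density[OF _ g]]
    by (intro nn_integral_mono)
      (auto simp: ennreal_mult' mult.assoc[symmetric] intro!: mult_right_mono)
  also have "\<dots> = (\<integral>\<^sup>+x. \<integral>\<^sup>+y. ?F x y \<partial>lborel \<partial>lborel)"
    by (rule nn_integral_shear) measurable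
  also have "\<dots> = ennreal (exp 3) * (\<integral>\<^sup>+x. \<integral>\<^sup>+y. f x y \<partial>gauss2 \<nu> \<sigma> \<partial>gauss2 \<mu> \<sigma>)"
    by (simp add: nn_integral_gauss2_pair nn_integral_cmult)
  finally show ?thesis .
qed

text \<open>Comparing with a wider Gaussian bounds the tail without computing an integral.\<close>
lemma gauss2_density_le_wider:
  assumes "\<sigma> > 0" "R \<ge> 0" "x \<notin> cball \<mu> (R * \<sigma>)"
  shows "gauss2_density \<mu> \<sigma> x \<le> 2 * exp (- R\<^sup>2 / 4) * gauss2_density \<mu> (sqrt 2 * \<sigma>) x"
proof -
  let ?q = "(norm (x - \<mu>))\<^sup>2"
  have "(R * \<sigma>)\<^sup>2 \<le> ?q"
    using assms by (intro power_mono) (auto simp: dist_norm norm_minus_commute)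
  then have "R\<^sup>2 \<le> ?q / \<sigma>\<^sup>2" using assms(1) by (simp add: power_mult_distrib field_simps)
  then have "- ?q / (2 * \<sigma>\<^sup>2) \<le> - R\<^sup>2 / 4 + - ?q / (4 * \<sigma>\<^sup>2)" by (simp add: field_simps)
  then have "exp (- ?q / (2 * \<sigma>\<^sup>2)) \<le> exp (- R\<^sup>2 / 4) * exp (- ?q / (4 * \<sigma>\<^sup>2))"
    unfolding exp_add[symmetric] by simp
  then have "gauss2_density \<mu> \<sigma> x \<le> exp (- R\<^sup>2 / 4) * exp (- ?q / (4 * \<sigma>\<^sup>2)) / (2 * pi * \<sigma>\<^sup>2)"
    unfolding gauss2_density_def by (intro divide_right_mono) auto
  also have "\<dots> = 2 * exp (- R\<^sup>2 / 4) * gauss2_density \<mu> (sqrt 2 * \<sigma>) x"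
    by (simp add: gauss2_density_def power_mult_distrib)
  finally show ?thesis .
qed

lemma gauss2_tail_le:
  assumes "\<sigma> > 0" "R \<ge> 0"
  shows "measure (gauss2 \<mu> \<sigma>) (- cball \<mu> (R * \<sigma>)) \<le> 2 * exp (- R\<^sup>2 / 4)"
proof -
  interpret prob_space "gauss2 \<mu> \<sigma>" using prob_space_gauss2[OF assms(1)] .
  interpret wider: prob_space "gauss2 \<mu> (sqrt 2 * \<sigma>)"
    using assms(1) by (intro prob_space_gauss2) simp
  let ?A = "- cball \<mu> (R * \<sigma>)" and ?c = "ennreal (2 * exp (- R\<^sup>2 / 4))"
  have "emeasure (gauss2 \<mu> \<sigma>) ?A = (\<integral>\<^sup>+x. ennreal (gauss2_density \<mu> \<sigma> x) * indicator ?A x \<partial>lborel)"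
    unfolding gauss2_eq_density by (rule emeasure_density) auto
  also have "\<dots> \<le> (\<integral>\<^sup>+x. ?c * ennreal (gauss2_density \<mu> (sqrt 2 * \<sigma>) x) \<partial>lborel)"
    using gauss2_density_le_wider[OF assms]
    by (intro nn_integral_mono)
      (auto simp: indicator_def ennreal_mult'[symmetric] intro!: ennreal_leI)
  also have "\<dots> = ?c * emeasure (gauss2 \<mu> (sqrt 2 * \<sigma>)) (space (gauss2 \<mu> (sqrt 2 * \<sigma>)))"
    by (simp add: gauss2_eq_density emeasure_density nn_integral_cmult)
  also have "\<dots> = ?c" by (simp only: wider.emeasure_space_1 mult_1_right)
  finally show ?thesis by (simp add: emeasure_eq_measure)
qed

section \<open>Measurability and expectations of counts\<close>

lemma measurable_card_image_filter:
  assumes "finite K" "\<And>k. k \<in> K \<Longrightarrow> Measurable.pred M (Q k)"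
    and "\<And>k l. k \<in> K \<Longrightarrow> l \<in> K \<Longrightarrow> Measurable.pred M (\<lambda>x. f x k = f x l)"
  shows "(\<lambda>x. card (f x ` {k \<in> K. Q k x})) \<in> measurable M (count_space UNIV)"
  using assms
proof (induction K)
  case (insert l K)
  have [measurable]: "Measurable.pred M (Q l)" using insert.prems(1) by simp
  have "Measurable.pred M (\<lambda>x. \<exists>k\<in>K. Q k x \<and> f x l = f x k)"
    using insert.hyps(1) insert.prems by (intro pred_intros_finite pred_intros_logic) auto
  then have new: "Measurable.pred M (\<lambda>x. f x l \<in> f x ` {k \<in> K. Q k x})"
    by (rule measurable_cong[THEN iffD1, rotated]) auto
  have "card (f x ` {k \<in> insert l K. Q k x}) =
      (if Q l x \<and> f x l \<notin> f x ` {k \<in> K. Q k x} then Suc (card (f x ` {k \<in> K. Q k x}))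
       else card (f x ` {k \<in> K. Q k x}))" for x
  proof -
    have "{k \<in> insert l K. Q k x} = (if Q l x then insert l {k \<in> K. Q k x} else {k \<in> K. Q k x})"
      by auto
    then show ?thesis using insert.hyps(1) by (simp add: card_insert_if)
  qed
  moreover have [measurable]: "(\<lambda>x. card (f x ` {k \<in> K. Q k x})) \<in> measurable M (count_space UNIV)"
    using insert by simp
  ultimately show ?case using new by simp
qed simp

lemma (in finite_measure) has_bochner_integral_card_filter:
  assumes "finite A" "\<And>p. p \<in> A \<Longrightarrow> Measurable.pred M (Q p)"
  shows "has_bochner_integral M (\<lambda>x. real (card {p \<in> A. Q p x}))
    (\<Sum>p\<in>A. measure M {x \<in> space M. Q p x})"
proof -
  have "has_bochner_integral M (\<lambda>x. \<Sum>p\<in>A. indicator {x \<in> space M. Q p x} x)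
      (\<Sum>p\<in>A. measure M {x \<in> space M. Q p x})"
    using assms(2) by (intro has_bochner_integral_sum has_bochner_integral_real_indicator)
      (auto simp: emeasure_eq_measure)
  moreover have "(\<Sum>p\<in>A. indicator {x \<in> space M. Q p x} x) = real (card {p \<in> A. Q p x})"
    if "x \<in> space M" for x
    using that assms(1) by (simp add: indicator_def Int_def)
  ultimately show ?thesis by (simp cong: has_bochner_integral_cong)
qed

lemma (in finite_measure) integral_le_integral_plus_measure:
  fixes f g :: "'a \<Rightarrow> real"
  assumes "integrable M f" "integrable M g" "A \<in> sets M"
    and "\<And>x. x \<in> space M \<Longrightarrow> f x \<le> g x + c * indicator A x"
  shows "(\<integral>x. f x \<partial>M) \<le> (\<integral>x. g x \<partial>M) + c * measure M A"
proof -
  have ind: "integrable M (\<lambda>x. c * indicator A x)" using assms(3) by (simp add: emeasure_eq_measure)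
  have "(\<integral>x. f x \<partial>M) \<le> (\<integral>x. g x + c * indicator A x \<partial>M)"
    using assms ind by (intro integral_mono) auto
  also have "\<dots> = (\<integral>x. g x \<partial>M) + c * measure M A"
    using assms(2,3) ind by (subst Bochner_Integration.integral_add) auto
  finally show ?thesis .
qed

lemma borel_measurable_perp [measurable]: "perp \<in> borel_measurable borel"
  using linear_perp by (intro borel_measurable_continuous_onI linear_continuous_on)
    (simp add: linear_conv_bounded_linear)

lemma borel_measurable_unit_normal [measurable (raw)]:
  assumes [measurable]: "f \<in> borel_measurable M" "g \<in> borel_measurable M"
  shows "(\<lambda>x. unit_normal (f x) (g x)) \<in> borel_measurable M"
  unfolding unit_normal_def sgn_div_norm by measurable

lemma pred_eq_borel [measurable (raw)]:
  fixes f g :: "'a \<Rightarrow> 'b::{second_countable_topology, metric_space}"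
  assumes [measurable]: "f \<in> borel_measurable M" "g \<in> borel_measurable M"
  shows "Measurable.pred M (\<lambda>x. f x = g x)"
proof -
  have "Measurable.pred M (\<lambda>x. dist (f x) (g x) = 0)" by measurable
  then show ?thesis by simp
qed

lemma pred_gapped_edge:
  assumes "finite I" "\<And>k. k \<in> I \<Longrightarrow> X k \<in> borel_measurable M"
    and [measurable]: "f \<in> borel_measurable M" "g \<in> borel_measurable M"
  shows "Measurable.pred M (\<lambda>\<omega>. gapped_edge \<tau> ((\<lambda>k. X k \<omega>) ` I) (f \<omega>) (g \<omega>))"
proof -
  have "Measurable.pred M (\<lambda>\<omega>. unit_normal (f \<omega>) (g \<omega>) \<bullet> (X k \<omega> - f \<omega>) \<le> - \<tau>)" if "k \<in> I" for k
    using assms(2)[OF that, measurable] by measurable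
  then show ?thesis
    unfolding gapped_edge_def ball_simps using assms(1)
    by (intro pred_intros_logic pred_intros_finite pred_eq_borel) auto
qed

lemma pred_oriented_edge:
  assumes "finite I" "\<And>k. k \<in> I \<Longrightarrow> X k \<in> borel_measurable M"
    and [measurable]: "f \<in> borel_measurable M" "g \<in> borel_measurable M"
  shows "Measurable.pred M (\<lambda>\<omega>. oriented_edge ((\<lambda>k. X k \<omega>) ` I) (f \<omega>) (g \<omega>))"
proof -
  have "Measurable.pred M (\<lambda>\<omega>. X k \<omega> \<in> closed_segment (f \<omega>) (g \<omega>) \<or>
      unit_normal (f \<omega>) (g \<omega>) \<bullet> (X k \<omega> - f \<omega>) < 0)" if "k \<in> I" for k
  proof -
    note [measurable] = assms(2)[OF that]
    show ?thesis unfolding between_mem_segment[symmetric] between by measurable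
  qed
  then show ?thesis
    unfolding oriented_edge_def ball_simps using assms(1)
    by (intro pred_intros_logic pred_intros_finite pred_eq_borel) auto
qed

text \<open>
  The edges are counted as an image, because coinciding points make several index pairs describe the
  same edge: integrability needs measurability everywhere, not only almost everywhere.
\<close>
lemma measurable_num_edges_convex_hull:
  assumes "finite I" and X: "\<And>k. k \<in> I \<Longrightarrow> X k \<in> borel_measurable M"
  shows "(\<lambda>\<omega>. num_edges (convex hull ((\<lambda>k. X k \<omega>) ` I))) \<in> measurable M (count_space UNIV)"
proof -
  let ?Q = "\<lambda>(i, j) \<omega>. oriented_edge ((\<lambda>k. X k \<omega>) ` I) (X i \<omega>) (X j \<omega>)"
  let ?seg = "\<lambda>\<omega> (i, j). closed_segment (X i \<omega>) (X j \<omega>)"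
  have "{e. e edge_of convex hull ((\<lambda>k. X k \<omega>) ` I)} = ?seg \<omega> ` {p \<in> I \<times> I. ?Q p \<omega>}" for \<omega>
    unfolding edges_of_convex_hull_eq[OF finite_imageI[OF assms(1)]] by force
  moreover have "(\<lambda>\<omega>. card (?seg \<omega> ` {p \<in> I \<times> I. ?Q p \<omega>})) \<in> measurable M (count_space UNIV)"
  proof (rule measurable_card_image_filter)
    show "Measurable.pred M (?Q p)" if "p \<in> I \<times> I" for p
      using that X pred_oriented_edge[OF assms] by auto
    show "Measurable.pred M (\<lambda>\<omega>. ?seg \<omega> p = ?seg \<omega> q)" if "p \<in> I \<times> I" "q \<in> I \<times> I" for p q
      using that X
      by (auto simp: doubleton_eq_iff intro!: pred_intros_logic pred_eq_borel)
  qed (use assms(1) in simp)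
  ultimately show ?thesis by (simp add: num_edges_def)
qed

section \<open>The expected number of edges\<close>

lemma (in product_sigma_finite) borel_measurable_nn_integral_insert:
  assumes "f \<in> borel_measurable (Pi\<^sub>M (insert i I) M)"
  shows "(\<lambda>x. \<integral>\<^sup>+y. f (x(i := y)) \<partial>M i) \<in> borel_measurable (Pi\<^sub>M I M)"
proof -
  have "(\<lambda>z. (fst z)(i := snd z)) \<in> Pi\<^sub>M I M \<Otimes>\<^sub>M M i \<rightarrow>\<^sub>M Pi\<^sub>M (insert i I) M"
    by measurable
  from measurable_compose[OF this assms] show ?thesis
    by (intro sigma_finite_measure.borel_measurable_nn_integral[OF sigma_finite_measures])
      (simp add: case_prod_beta')
qed

lemma (in product_sigma_finite) product_nn_integral_insert_insert:
  assumes "finite I" "i \<notin> I" "j \<notin> I" "i \<noteq> j"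
    and f: "f \<in> borel_measurable (Pi\<^sub>M (insert j (insert i I)) M)"
  shows "integral\<^sup>N (Pi\<^sub>M (insert j (insert i I)) M) f =
    (\<integral>\<^sup>+r. \<integral>\<^sup>+x. \<integral>\<^sup>+y. f (r(i := x, j := y)) \<partial>M j \<partial>M i \<partial>Pi\<^sub>M I M)"
proof -
  have "integral\<^sup>N (Pi\<^sub>M (insert j (insert i I)) M) f =
      (\<integral>\<^sup>+r. \<integral>\<^sup>+y. f (r(j := y)) \<partial>M j \<partial>Pi\<^sub>M (insert i I) M)"
    using assms by (intro product_nn_integral_insert) auto
  also have "\<dots> = (\<integral>\<^sup>+r. \<integral>\<^sup>+x. \<integral>\<^sup>+y. f (r(i := x, j := y)) \<partial>M j \<partial>M i \<partial>Pi\<^sub>M I M)"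
    by (intro product_nn_integral_insert assms(1,2) borel_measurable_nn_integral_insert f)
  finally show ?thesis .
qed

locale gaussian_points =
  fixes I :: "'i set" and abar :: "'i \<Rightarrow> real ^ 2" and \<sigma> :: real
  assumes finite_I [simp]: "finite I" and sigma_pos: "\<sigma> > 0"
begin

abbreviation P :: "('i \<Rightarrow> real ^ 2) measure" where
  "P \<equiv> \<Pi>\<^sub>M k\<in>I. gauss2 (abar k) \<sigma>"

sublocale product_prob_space "\<lambda>k. gauss2 (abar k) \<sigma>" I
  by (rule product_prob_spaceI) (rule prob_space_gauss2[OF sigma_pos])

lemma measurable_component [measurable]: "k \<in> I \<Longrightarrow> (\<lambda>a. a k) \<in> borel_measurable P"
  using measurable_component_singleton[of k I "\<lambda>k. gauss2 (abar k) \<sigma>"]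
  by (simp add: measurable_cong_sets[OF refl sets_gauss2])

definition near :: "real \<Rightarrow> 'i \<Rightarrow> ('i \<Rightarrow> real ^ 2) \<Rightarrow> bool" where
  "near R k a \<longleftrightarrow> a k \<in> cball (abar k) (R * \<sigma>)"

lemma pred_near [measurable]: "k \<in> I \<Longrightarrow> Measurable.pred P (near R k)"
  unfolding near_def mem_cball by measurable

lemma prob_not_near_le:
  assumes "k \<in> I" "R \<ge> 0"
  shows "prob {a \<in> space P. \<not> near R k a} \<le> 2 * exp (- R\<^sup>2 / 4)"
proof -
  have "- cball (abar k) (R * \<sigma>) \<in> sets (gauss2 (abar k) \<sigma>)" by simp
  from emeasure_PiM_Collect_single[OF assms(1) this]
  have "prob {a \<in> space P. \<not> near R k a} = measure (gauss2 (abar k) \<sigma>) (- cball (abar k) (R * \<sigma>))"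
    by (simp add: measure_def near_def)
  then show ?thesis using gauss2_tail_le[OF sigma_pos assms(2)] by simp
qed

definition outlier_event :: "real \<Rightarrow> ('i \<Rightarrow> real ^ 2) set" where
  "outlier_event R = {a \<in> space P. \<exists>k\<in>I. \<not> near R k a}"

lemma outlier_event_in_events [measurable]: "outlier_event R \<in> events"
proof -
  have "Measurable.pred P (\<lambda>a. \<exists>k\<in>I. \<not> near R k a)"
    by (intro pred_intros_finite pred_intros_logic pred_near finite_I)
  then show ?thesis unfolding outlier_event_def by simp
qed

lemma prob_outlier_event_le:
  assumes "R \<ge> 0"
  shows "prob (outlier_event R) \<le> 2 * real (card I) * exp (- R\<^sup>2 / 4)"
proof -
  have "outlier_event R = (\<Union>k\<in>I. {a \<in> space P. \<not> near R k a})"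
    by (auto simp: outlier_event_def)
  also have "prob \<dots> \<le> (\<Sum>k\<in>I. prob {a \<in> space P. \<not> near R k a})"
    by (rule measure_UNION_le) auto
  also have "\<dots> \<le> real (card I) * (2 * exp (- R\<^sup>2 / 4))"
    by (intro sum_bounded_above prob_not_near_le assms)
  finally show ?thesis by simp
qed

lemma nn_integral_shear_pair_le:
  assumes ij: "i \<in> I" "j \<in> I" "i \<noteq> j" and "R \<ge> 1"
    and F [measurable]: "F \<in> borel_measurable P"
    and g [measurable]: "g \<in> borel_measurable borel" and g_le: "\<And>d. norm (g d) \<le> \<sigma> / R"
  shows "(\<integral>\<^sup>+a. (if near R i a \<and> near R j a then F (shear_pair g i j a) else 0) \<partial>P)
    \<le> ennreal (exp 3) * (\<integral>\<^sup>+a. F a \<partial>P)"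
proof -
  let ?M = "\<lambda>k. gauss2 (abar k) \<sigma>"
  define J where "J = I - {i, j}"
  have I: "I = insert j (insert i J)" and J: "finite J" "i \<notin> J" "j \<notin> J"
    using ij by (auto simp: J_def)
  note Fubini = product_nn_integral_insert_insert[OF J ij(3), folded I]
  note [measurable] = ij(1,2)
  have [measurable]: "shear_pair g i j \<in> P \<rightarrow>\<^sub>M P"
    unfolding shear_pair_def using ij by (intro measurable_fun_upd[where J = I]) auto
  have shear_upd: "shear_pair g i j (r(i := x, j := y)) = r(i := x + g (y - x), j := y + g (y - x))"
    for r x y
    using ij(3) by (auto simp: shear_pair_def)
  have "(\<integral>\<^sup>+a. (if near R i a \<and> near R j a then F (shear_pair g i j a) else 0) \<partial>P)
      = (\<integral>\<^sup>+r. \<integral>\<^sup>+x. \<integral>\<^sup>+y. (if x \<in> cball (abar i) (R * \<sigma>) \<and> y \<in> cball (abar j) (R * \<sigma>)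
          then F (r(i := x + g (y - x), j := y + g (y - x))) else 0) \<partial>?M j \<partial>?M i \<partial>Pi\<^sub>M J ?M)"
    by (subst Fubini) (measurable, simp add: near_def shear_upd ij(3) cong: if_cong)
  also have "\<dots> \<le> (\<integral>\<^sup>+r. ennreal (exp 3) * (\<integral>\<^sup>+x. \<integral>\<^sup>+y. F (r(i := x, j := y)) \<partial>?M j \<partial>?M i)
      \<partial>Pi\<^sub>M J ?M)"
  proof (intro nn_integral_mono nn_integral_gauss2_shear_le sigma_pos \<open>R \<ge> 1\<close> g g_le)
    fix r assume "r \<in> space (Pi\<^sub>M J ?M)"
    then have "(\<lambda>(x, y). r(i := x, j := y)) \<in> borel \<Otimes>\<^sub>M borel \<rightarrow>\<^sub>M P"
      unfolding case_prod_beta' I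
      by (intro measurable_fun_upd[where J = "insert i J"] measurable_fun_upd[where J = J]) auto
    then show "(\<lambda>(x, y). F (r(i := x, j := y))) \<in> borel_measurable (borel \<Otimes>\<^sub>M borel)"
      using F measurable_compose by (simp add: case_prod_beta')
  qed
  also have "\<dots> = ennreal (exp 3) * (\<integral>\<^sup>+a. F a \<partial>P)"
    unfolding Fubini[OF F]
    by (intro nn_integral_cmult borel_measurable_nn_integral_insert) (use F I in simp)
  finally show ?thesis .
qed

lemma pred_gapped_edges [measurable]:
  "p \<in> I \<times> I \<Longrightarrow> Measurable.pred P (\<lambda>a. p \<in> gapped_edges \<tau> I a)"
  using pred_gapped_edge[of "I - {fst p, snd p}" "\<lambda>k a. a k" P "\<lambda>a. a (fst p)" "\<lambda>a. a (snd p)" \<tau>]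
  by (cases p) (simp add: gapped_edges_def)

lemma prob_gapped_edge_le:
  assumes p: "p \<in> I \<times> I" and "R \<ge> 1"
  shows "prob {a \<in> space P. p \<in> gapped_edges 0 I a \<and> near R (fst p) a \<and> near R (snd p) a}
    \<le> exp 3 * prob {a \<in> space P. p \<in> gapped_edges (\<sigma> / R) I a}"
proof (cases "fst p = snd p")
  case True
  then have "p \<notin> gapped_edges 0 I a" for a by (auto simp: gapped_edges_def gapped_edge_def)
  then show ?thesis by simp
next
  case False
  obtain i j where [simp]: "p = (i, j)" and ij [measurable]: "i \<in> I" "j \<in> I" using p by auto
  have "i \<noteq> j" using False by simp
  let ?A = "{a \<in> space P. p \<in> gapped_edges 0 I a \<and> near R i a \<and> near R j a}"
    and ?B = "{a \<in> space P. p \<in> gapped_edges (\<sigma> / R) I a}"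
  let ?shear = "shear_pair (\<lambda>d. (\<sigma> / R) *\<^sub>R unit_normal 0 d) i j"
  have ind: "indicator ?A a =
      (if near R i a \<and> near R j a then indicator ?B (?shear a) else 0 :: ennreal)"
    if "a \<in> space P" for a
  proof -
    have "?shear a \<in> space P"
      using that ij by (auto simp: shear_pair_def space_PiM PiE_iff extensional_def)
    then show ?thesis
      using that gapped_edges_shear_pair[OF \<open>i \<noteq> j\<close>] by (simp add: indicator_def)
  qed
  have "emeasure P ?A = (\<integral>\<^sup>+a. indicator ?A a \<partial>P)"
    using p by (intro nn_integral_indicator[symmetric]) measurable
  also have "\<dots> = (\<integral>\<^sup>+a. (if near R i a \<and> near R j a then indicator ?B (?shear a) else 0) \<partial>P)"
    by (intro nn_integral_cong ind)
  also have "\<dots> \<le> ennreal (exp 3) * (\<integral>\<^sup>+a. indicator ?B a \<partial>P)"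
    using ij \<open>i \<noteq> j\<close> \<open>R \<ge> 1\<close> sigma_pos norm_unit_normal_le p
    by (intro nn_integral_shear_pair_le) (auto simp: divide_right_mono mult_left_le)
  also have "(\<integral>\<^sup>+a. indicator ?B a \<partial>P) = emeasure P ?B"
    using p by (intro nn_integral_indicator) measurable
  finally show ?thesis by (simp add: emeasure_eq_measure ennreal_mult'[symmetric])
qed

lemma card_gapped_edges_le_card_squared: "real (card (gapped_edges \<tau> I a)) \<le> (real (card I))\<^sup>2"
proof -
  have "card (gapped_edges \<tau> I a) \<le> card (I \<times> I)"
    by (rule card_mono) (auto simp: gapped_edges_def)
  then show ?thesis unfolding power2_eq_square card_cartesian_product by (simp flip: of_nat_mult)
qed

lemma num_edges_le_card_squared: "real (num_edges (convex hull (a ` I))) \<le> (real (card I))\<^sup>2"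
  using num_edges_le_card_gapped_edges[OF finite_I, of a] card_gapped_edges_le_card_squared[of 0 a]
  by linarith

lemma integrable_num_edges: "integrable P (\<lambda>a. real (num_edges (convex hull (a ` I))))"
proof (rule P.integrable_const_bound)
  show "AE a in P. norm (real (num_edges (convex hull (a ` I)))) \<le> (real (card I))\<^sup>2"
    using num_edges_le_card_squared by simp
  show "(\<lambda>a. real (num_edges (convex hull (a ` I)))) \<in> borel_measurable P"
    using measurable_num_edges_convex_hull[of I "\<lambda>k a. a k" P]
    by (intro measurable_compose[OF _ borel_measurable_count_space]) auto
qed

lemma has_bochner_integral_card_gapped_edges:
  "has_bochner_integral P (\<lambda>a. real (card (gapped_edges \<tau> I a)))
    (\<Sum>p\<in>I \<times> I. prob {a \<in> space P. p \<in> gapped_edges \<tau> I a})"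
proof -
  have "has_bochner_integral P (\<lambda>a. real (card {p \<in> I \<times> I. p \<in> gapped_edges \<tau> I a}))
      (\<Sum>p\<in>I \<times> I. prob {a \<in> space P. p \<in> gapped_edges \<tau> I a})"
    by (intro P.has_bochner_integral_card_filter pred_gapped_edges) auto
  moreover have "{p \<in> I \<times> I. p \<in> gapped_edges \<tau> I a} = gapped_edges \<tau> I a" for a
    by (auto simp: gapped_edges_def)
  ultimately show ?thesis by simp
qed

lemma expectation_num_edges_le_gapped_edges:
  assumes "R \<ge> 1"
  shows "expectation (\<lambda>a. real (num_edges (convex hull (a ` I))))
    \<le> exp 3 * expectation (\<lambda>a. real (card (gapped_edges (\<sigma> / R) I a)))
      + (real (card I))\<^sup>2 * prob (outlier_event R)"
proof -
  define G where "G p a \<longleftrightarrow> p \<in> gapped_edges 0 I a \<and> near R (fst p) a \<and> near R (snd p) a" for p a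
  have "Measurable.pred P (G p)" if "p \<in> I \<times> I" for p
    using that unfolding G_def by (intro pred_intros_logic pred_gapped_edges pred_near) auto
  then have card_G: "has_bochner_integral P (\<lambda>a. real (card {p \<in> I \<times> I. G p a}))
      (\<Sum>p\<in>I \<times> I. prob {a \<in> space P. G p a})"
    by (intro P.has_bochner_integral_card_filter) auto
  have "expectation (\<lambda>a. real (num_edges (convex hull (a ` I))))
    \<le> expectation (\<lambda>a. real (card {p \<in> I \<times> I. G p a})) + (real (card I))\<^sup>2 * prob (outlier_event R)"
  proof (intro P.integral_le_integral_plus_measure integrable_num_edges
      integrable.intros[OF card_G])
    fix a assume "a \<in> space P"
    show "real (num_edges (convex hull (a ` I)))
      \<le> real (card {p \<in> I \<times> I. G p a}) + (real (card I))\<^sup>2 * indicator (outlier_event R) a"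
    proof (cases "a \<in> outlier_event R")
      case True
      then show ?thesis by (intro order_trans[OF num_edges_le_card_squared]) simp
    next
      case False
      then have "gapped_edges 0 I a = {p \<in> I \<times> I. G p a}"
        using \<open>a \<in> space P\<close> by (auto simp: G_def outlier_event_def gapped_edges_def)
      then show ?thesis using num_edges_le_card_gapped_edges[OF finite_I, of a] False by simp
    qed
  qed simp
  also have "expectation (\<lambda>a. real (card {p \<in> I \<times> I. G p a}))
      \<le> exp 3 * expectation (\<lambda>a. real (card (gapped_edges (\<sigma> / R) I a)))"
    unfolding has_bochner_integral_integral_eq[OF card_G] sum_distrib_left
      has_bochner_integral_integral_eq[OF has_bochner_integral_card_gapped_edges]
    using prob_gapped_edge_le[OF _ assms] by (intro sum_mono) (simp add: G_def)
  finally show ?thesis by simp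
qed

lemma expectation_card_gapped_edges_le:
  assumes "3 \<le> card I" "\<And>k. k \<in> I \<Longrightarrow> norm (abar k) \<le> 1" "R \<ge> 0" "\<tau> > 0"
  shows "expectation (\<lambda>a. real (card (gapped_edges \<tau> I a)))
    \<le> 4 * (1 + 4 * sqrt ((1 + R * \<sigma>) / \<tau>)) + (real (card I))\<^sup>2 * prob (outlier_event R)"
proof -
  let ?B = "4 * (1 + 4 * sqrt ((1 + R * \<sigma>) / \<tau>))"
  have D: "1 + R * \<sigma> > 0" using assms(3) sigma_pos by (simp add: add_pos_nonneg)
  have "expectation (\<lambda>a. real (card (gapped_edges \<tau> I a)))
      \<le> expectation (\<lambda>_. ?B) + (real (card I))\<^sup>2 * prob (outlier_event R)"
  proof (rule P.integral_le_integral_plus_measure)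
    fix a assume "a \<in> space P"
    show "real (card (gapped_edges \<tau> I a)) \<le> ?B + (real (card I))\<^sup>2 * indicator (outlier_event R) a"
    proof (cases "a \<in> outlier_event R")
      case True
      have "?B \<ge> 0" using D assms(4) by simp
      then show ?thesis
        using True by (intro order_trans[OF card_gapped_edges_le_card_squared]) simp
    next
      case False
      have "norm (a k) \<le> 1 + R * \<sigma>" if "k \<in> I" for k
      proof -
        have "norm (a k - abar k) \<le> R * \<sigma>"
          using False \<open>a \<in> space P\<close> that
          by (auto simp: outlier_event_def near_def dist_norm norm_minus_commute)
        then show ?thesis using norm_triangle_sub[of "a k" "abar k"] assms(2)[OF that] by linarith
      qed
      then show ?thesis using card_gapped_edges_le[OF finite_I assms(1,4) D] False by simp
    qed
  qed (use integrable.intros[OF has_bochner_integral_card_gapped_edges] in auto)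
  then show ?thesis by (simp add: P.prob_space)
qed

lemma expectation_num_edges_le:
  assumes "3 \<le> card I" "\<And>k. k \<in> I \<Longrightarrow> norm (abar k) \<le> 1" "R \<ge> 1"
  shows "expectation (\<lambda>a. real (num_edges (convex hull (a ` I))))
    \<le> exp 3 * (4 * (1 + 4 * sqrt ((1 + R * \<sigma>) / (\<sigma> / R)))
        + 2 * (real (card I) ^ 3 * exp (- R\<^sup>2 / 4)))
      + 2 * (real (card I) ^ 3 * exp (- R\<^sup>2 / 4))"
proof -
  let ?n = "real (card I)" and ?B = "4 * (1 + 4 * sqrt ((1 + R * \<sigma>) / (\<sigma> / R)))"
  have "?n\<^sup>2 * prob (outlier_event R) \<le> ?n\<^sup>2 * (2 * ?n * exp (- R\<^sup>2 / 4))"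
    using prob_outlier_event_le[of R] assms(3) by (intro mult_left_mono) auto
  then have outlier: "?n\<^sup>2 * prob (outlier_event R) \<le> 2 * (?n ^ 3 * exp (- R\<^sup>2 / 4))"
    by (simp add: power2_eq_square power3_eq_cube ac_simps)
  have "expectation (\<lambda>a. real (card (gapped_edges (\<sigma> / R) I a)))
      \<le> ?B + 2 * (?n ^ 3 * exp (- R\<^sup>2 / 4))"
    using expectation_card_gapped_edges_le[of R "\<sigma> / R"] assms sigma_pos outlier by fastforce
  then have "exp 3 * expectation (\<lambda>a. real (card (gapped_edges (\<sigma> / R) I a)))
      \<le> exp 3 * (?B + 2 * (?n ^ 3 * exp (- R\<^sup>2 / 4)))"
    by (intro mult_left_mono) auto
  then show ?thesis
    using expectation_num_edges_le_gapped_edges[OF assms(3)] outlier by linarith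
qed

end

lemma sqrt_radius_over_gap_le:
  assumes "\<sigma> > 0" "L > 0"
  defines "R \<equiv> sqrt (12 * L)"
  shows "sqrt ((1 + R * \<sigma>) / (\<sigma> / R)) \<le> 4 * (root 4 L / sqrt \<sigma> + sqrt L)"
proof -
  have R: "0 < R" "R \<le> 4 * sqrt L"
    unfolding R_def using assms(2) by (auto intro!: real_le_lsqrt simp: power_mult_distrib)
  have "(1 + R * \<sigma>) / (\<sigma> / R) = R / \<sigma> + R\<^sup>2"
    using assms(1) R(1) by (simp add: field_simps power2_eq_square)
  also have "sqrt \<dots> \<le> sqrt (R / \<sigma>) + R"
    using sqrt_add_le_add_sqrt[of "R / \<sigma>" "R\<^sup>2"] assms(1) R(1) by simp
  also have "sqrt (R / \<sigma>) \<le> 2 * (root 4 L / sqrt \<sigma>)"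
  proof -
    have "sqrt R \<le> sqrt (4 * sqrt L)" using R(2) by simp
    also have "\<dots> = 2 * root 4 L"
      using real_root_mult_exp[of 2 2 L] by (simp add: real_sqrt_mult flip: sqrt_def)
    finally show ?thesis using assms(1) by (simp add: real_sqrt_divide divide_right_mono)
  qed
  finally have "sqrt ((1 + R * \<sigma>) / (\<sigma> / R)) \<le> 2 * (root 4 L / sqrt \<sigma>) + R" by simp
  moreover have "0 \<le> root 4 L / sqrt \<sigma>" using assms(1,2) by simp
  ultimately show ?thesis using R(2) unfolding distrib_left by linarith
qed

lemma cube_mult_exp_neg_ln:
  assumes "x > 0"
  shows "x ^ 3 * exp (- (3 * ln x)) = (1 :: real)"
  using assms exp_of_nat_mult[of 3 "ln x"] by (simp add: exp_minus)

theorem mainTheorem4: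
  shows "\<exists>C::real. C > 0 \<and>
    (\<forall>(n::nat) (\<sigma>::real) (abar :: nat \<Rightarrow> real ^ 2).
      n > 2 \<longrightarrow> \<sigma> > 0 \<longrightarrow> (\<forall>i\<in>{1..n}. norm (abar i) \<le> 1) \<longrightarrow>
      (let P = (\<Pi>\<^sub>M i\<in>{1..n}. gauss2 (abar i) \<sigma>);
           X = (\<lambda>a. real (num_edges (convex hull (a ` {1..n}))))
       in integrable P X \<and>
          prob_space.expectation P X
            \<le> C * (root 4 (ln (real n)) / sqrt \<sigma> + sqrt (ln (real n)))))"
proof (intro exI[of _ "72 * exp 3"] conjI allI impI)
  fix n :: nat and \<sigma> :: real and abar :: "nat \<Rightarrow> real ^ 2"
  assume n: "n > 2" and \<sigma>: "\<sigma> > 0" and abar: "\<forall>i\<in>{1..n}. norm (abar i) \<le> 1"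
  interpret gaussian_points "{1..n}" abar \<sigma> by unfold_locales (use \<sigma> in auto)
  let ?L = "ln (real n)" and ?X = "\<lambda>a. real (num_edges (convex hull (a ` {1..n})))"
  let ?r = "root 4 ?L / sqrt \<sigma> + sqrt ?L"
  have L: "?L \<ge> 1" using exp_le n by (subst ln_ge_iff) auto
  have "?r \<ge> 1" using L \<sigma> by (intro add_increasing) auto
  define R where "R = sqrt (12 * ?L)"
  have "R \<ge> 1" and "real n ^ 3 * exp (- R\<^sup>2 / 4) = 1"
    using L n cube_mult_exp_neg_ln[of "real n"] by (simp_all add: R_def)
  then have "expectation ?X \<le> exp 3 * (4 * (1 + 4 * sqrt ((1 + R * \<sigma>) / (\<sigma> / R))) + 2) + 2"
    using expectation_num_edges_le[of R] n abar by simp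
  also have "\<dots> \<le> exp 3 * (4 * (1 + 4 * (4 * ?r)) + 2) + exp 3 * 2"
    using sqrt_radius_over_gap_le[OF \<sigma>, of ?L] L unfolding R_def
    by (intro add_mono mult_left_mono) auto
  also have "\<dots> = exp 3 * (64 * ?r + 8)" by (simp add: algebra_simps)
  also have "\<dots> \<le> exp 3 * (72 * ?r)" using \<open>?r \<ge> 1\<close> by (intro mult_left_mono) auto
  finally show "let P = (\<Pi>\<^sub>M i\<in>{1..n}. gauss2 (abar i) \<sigma>); X = ?X
      in integrable P X \<and> prob_space.expectation P X \<le> 72 * exp 3 * ?r"
    using integrable_num_edges by (simp add: Let_def mult_ac)
qed simp

end
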